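(* For coprime integers $M, N \ge 1$, we have a graph isomorphism $G_M \otimes G_N \cong G_{MN}$ if and only if either $-1 \in Q_M$ or $-1 \in Q_N$.
   Context: For an integer $n \ge 1$, $\mathbb{Z}_n$ is the ring of integers modulo $n$ and $\mathbb{Z}_n^\times$ its group of units. $Q_n = \{u^2 : u \in \mathbb{Z}_n^\times\}$ is the group of quadratic units modulo $n$, and $T_n = \pm Q_n = \{\pm u^2 : u \in \mathbb{Z}_n^\times\}$. The quadratic unitary Cayley graph $G_n = \mathrm{Cay}(\mathbb{Z}_n, T_n)$ is the undirected graph with vertex set $\mathbb{Z}_n$ in which $a,b$ are adjacent iff $a-b \in T_n$ (so for $n=1$ the single vertex carries a loop). The tensor product $A \otimes B$ of graphs has vertex set $V(A)\times V(B)$, where $(u,u')$ is adjacent to $(v,v')$ iff $u$ is adjacent to $v$ in $A$ and $u'$ is adjacent to $v'$ in $B$. *)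

theory Defs
  imports "HOL-Algebra.IntRing" "Graph_Theory.Graph_Theory"
begin

text \<open>The ring of integers modulo \<open>n\<close> is the quotient \<open>ZFact n\<close> of the integers by the ideal
  generated by \<open>n\<close>. For \<open>n = 1\<close> it is the zero ring, whose only element is a unit
  (\<open>residue_ring 1\<close> would not do: its multiplicative identity lies outside its carrier).\<close>

definition quad_units :: "int \<Rightarrow> int set set" where
  "quad_units n = {u [^]\<^bsub>ZFact n\<^esub> (2::nat) | u. u \<in> Units (ZFact n)}"

definition pm_quad_units :: "int \<Rightarrow> int set set" where
  "pm_quad_units n = quad_units n \<union> {\<ominus>\<^bsub>ZFact n\<^esub> q | q. q \<in> quad_units n}"

text \<open>An undirected graph, possibly with loops but without multiple edges, is a
  \<open>pair_pre_digraph\<close> with a symmetric arc relation; a loop at \<open>a\<close> is the arc \<open>(a, a)\<close>.\<close>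

definition cayley_graph :: "('a, 'm) ring_scheme \<Rightarrow> 'a set \<Rightarrow> 'a pair_pre_digraph" where
  "cayley_graph R S =
    \<lparr> pverts = carrier R,
      parcs = {(a, b). a \<in> carrier R \<and> b \<in> carrier R \<and> a \<ominus>\<^bsub>R\<^esub> b \<in> S} \<rparr>"

definition quad_cayley_graph :: "int \<Rightarrow> int set pair_pre_digraph" where
  "quad_cayley_graph n = cayley_graph (ZFact n) (pm_quad_units n)"

definition tensor_product ::
    "'a pair_pre_digraph \<Rightarrow> 'b pair_pre_digraph \<Rightarrow> ('a \<times> 'b) pair_pre_digraph" where
  "tensor_product A B =
    \<lparr> pverts = pverts A \<times> pverts B,
      parcs = {((u, u'), (v, v')) | u u' v v'. (u, v) \<in> parcs A \<and> (u', v') \<in> parcs B} \<rparr>"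

definition graph_iso :: "'a pair_pre_digraph \<Rightarrow> 'b pair_pre_digraph \<Rightarrow> bool" where
  "graph_iso G H \<longleftrightarrow> digraph_iso (with_proj G) (with_proj H)"

text \<open>As arcs are determined by their ends, \<open>digraph_iso\<close> amounts to a bijection between the vertex
  sets that preserves and reflects adjacency.\<close>

lemma graph_iso_iff:
  assumes G: "pair_wf_digraph G" and H: "pair_wf_digraph H"
  shows "graph_iso G H \<longleftrightarrow>
    (\<exists>f. bij_betw f (pverts G) (pverts H) \<and>
      (\<forall>a \<in> pverts G. \<forall>b \<in> pverts G. (a, b) \<in> parcs G \<longleftrightarrow> (f a, f b) \<in> parcs H))"
    (is "_ \<longleftrightarrow> (\<exists>f. ?P f)")
proof
  interpret G: pair_wf_digraph G by (rule G)
  assume "graph_iso G H"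
  then obtain h where h: "pre_digraph.digraph_isomorphism (with_proj G) h"
    and eq: "with_proj H = app_iso h (with_proj G)"
    unfolding graph_iso_def digraph_iso_def by blast
  let ?f = "iso_verts h"
  have V: "pverts H = ?f ` pverts G" and A: "parcs H = iso_arcs h ` parcs G"
    and T: "iso_tail h = fst" and D: "iso_head h = snd"
    using eq by (auto simp: app_iso_def with_proj_def)
  have inj: "inj_on ?f (pverts G)"
    using h by (simp add: pre_digraph.digraph_isomorphism_def)
  have arc: "iso_arcs h e = (?f (fst e), ?f (snd e))" if "e \<in> parcs G" for e
    using h that T D by (simp add: pre_digraph.digraph_isomorphism_def prod_eq_iff)
  have "(a, b) \<in> parcs G \<longleftrightarrow> (?f a, ?f b) \<in> parcs H" if "a \<in> pverts G" "b \<in> pverts G" for a b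
  proof
    assume "(a, b) \<in> parcs G"
    then show "(?f a, ?f b) \<in> parcs H"
      using arc unfolding A by force
  next
    assume "(?f a, ?f b) \<in> parcs H"
    then obtain c d where cd: "(c, d) \<in> parcs G" "?f a = ?f c" "?f b = ?f d"
      using arc unfolding A by force
    then have "a = c" "b = d"
      using inj that G.in_arcsD1 G.in_arcsD2 by (metis inj_onD)+
    then show "(a, b) \<in> parcs G" using cd by simp
  qed
  then show "\<exists>f. ?P f"
    using inj V by (auto simp: bij_betw_def)
next
  interpret G: pair_wf_digraph G by (rule G)
  interpret H: pair_wf_digraph H by (rule H)
  assume "\<exists>f. ?P f"
  then obtain f where f: "inj_on f (pverts G)" "f ` pverts G = pverts H"
    and adj: "\<And>a b. a \<in> pverts G \<Longrightarrow> b \<in> pverts G \<Longrightarrow> (a, b) \<in> parcs G \<longleftrightarrow> (f a, f b) \<in> parcs H"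
    by (auto simp: bij_betw_def)
  let ?h = "\<lparr>iso_verts = f, iso_arcs = map_prod f f, iso_head = snd, iso_tail = fst\<rparr>"
  have sub: "parcs G \<subseteq> pverts G \<times> pverts G"
    using G.in_arcsD1 G.in_arcsD2 by auto
  have "inj_on (map_prod f f) (parcs G)"
    using map_prod_inj_on[OF f(1) f(1)] sub by (rule inj_on_subset)
  then have "pre_digraph.digraph_isomorphism (with_proj G) ?h"
    using f G.wf_digraph by (simp add: pre_digraph.digraph_isomorphism_def)
  moreover have "parcs H = map_prod f f ` parcs G"
  proof (intro equalityI subsetI)
    fix e assume e: "e \<in> parcs H"
    then obtain x y where xy: "e = (x, y)" "x \<in> pverts H" "y \<in> pverts H"
      using H.in_arcsD1 H.in_arcsD2 by (cases e) auto
    then obtain a b where "x = f a" "y = f b" "a \<in> pverts G" "b \<in> pverts G"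
      using f(2) by blast
    then show "e \<in> map_prod f f ` parcs G"
      using adj e xy by force
  next
    fix e assume "e \<in> map_prod f f ` parcs G"
    then obtain a b where "(a, b) \<in> parcs G" "e = (f a, f b)"
      by auto
    then show "e \<in> parcs H"
      using adj[of a b] G.in_arcsD1[of a b] G.in_arcsD2[of a b] by simp
  qed
  then have "with_proj H = app_iso ?h (with_proj G)"
    using f by (simp add: app_iso_def with_proj_def)
  ultimately show "graph_iso G H"
    unfolding graph_iso_def digraph_iso_def by blast
qed

lemma pair_sym_digraph_quad_cayley_graph: "pair_sym_digraph (quad_cayley_graph n)"
proof -
  interpret R: cring "ZFact n" by (rule ZFact_is_cring)
  have Q: "q \<in> carrier (ZFact n)" if "q \<in> quad_units n" for q
    using that R.Units_closed by (auto simp: quad_units_def)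
  have T: "\<ominus>\<^bsub>ZFact n\<^esub> t \<in> pm_quad_units n" if "t \<in> pm_quad_units n" for t
    using that Q R.minus_minus by (auto simp: pm_quad_units_def)
  have m: "b \<ominus>\<^bsub>ZFact n\<^esub> a = \<ominus>\<^bsub>ZFact n\<^esub> (a \<ominus>\<^bsub>ZFact n\<^esub> b)"
    if "a \<in> carrier (ZFact n)" "b \<in> carrier (ZFact n)" for a b
    using that by (simp add: R.minus_eq R.minus_add R.a_comm)
  have "sym (parcs (quad_cayley_graph n))"
  proof (rule symI)
    fix a b assume "(a, b) \<in> parcs (quad_cayley_graph n)"
    then have "a \<in> carrier (ZFact n)" "b \<in> carrier (ZFact n)"
      "a \<ominus>\<^bsub>ZFact n\<^esub> b \<in> pm_quad_units n"
      by (simp_all add: quad_cayley_graph_def cayley_graph_def)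
    then show "(b, a) \<in> parcs (quad_cayley_graph n)"
      using T[of "a \<ominus>\<^bsub>ZFact n\<^esub> b"] m[of a b]
      by (simp add: quad_cayley_graph_def cayley_graph_def)
  qed
  moreover have "pair_wf_digraph (quad_cayley_graph n)"
    by unfold_locales (auto simp: quad_cayley_graph_def cayley_graph_def)
  ultimately show ?thesis
    by (simp add: pair_sym_digraph_def pair_sym_digraph_axioms_def symmetric_def)
qed

lemma pair_wf_digraph_tensor_product:
  assumes "pair_wf_digraph A" "pair_wf_digraph B"
  shows "pair_wf_digraph (tensor_product A B)"
  using assms by (auto simp: pair_wf_digraph_def tensor_product_def)

end

theory Submission
  imports Defs "HOL-Algebra.Chinese_Remainder"
begin

text \<open>By the Chinese remainder theorem \<open>G\<^sub>M \<otimes> G\<^sub>N\<close> is the Cayley graph of \<open>\<int>\<^sub>M\<^sub>N\<close> on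
  \<open>T\<^sub>M \<times> T\<^sub>N\<close>, while \<open>T\<^sub>M\<^sub>N\<close> corresponds to \<open>\<plusminus>(Q\<^sub>M \<times> Q\<^sub>N)\<close>. These connection sets agree as soon
  as \<open>-1\<close> lies in \<open>Q\<^sub>M\<close> or \<open>Q\<^sub>N\<close>. Otherwise \<open>T\<^sub>M\<close> and \<open>T\<^sub>N\<close> are twice as large as \<open>Q\<^sub>M\<close> and
  \<open>Q\<^sub>N\<close>, so that the two graphs are regular of degrees \<open>4\<bar>Q\<^sub>M\<bar>\<bar>Q\<^sub>N\<bar>\<close> and at most
  \<open>2\<bar>Q\<^sub>M\<bar>\<bar>Q\<^sub>N\<bar>\<close>.\<close>

section \<open>Squares of units and their negatives in an arbitrary ring\<close>

definition unit_squares :: "('a, 'm) ring_scheme \<Rightarrow> 'a set" where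
  "unit_squares R = (\<lambda>u. u \<otimes>\<^bsub>R\<^esub> u) ` Units R"

definition pm_unit_squares :: "('a, 'm) ring_scheme \<Rightarrow> 'a set" where
  "pm_unit_squares R = unit_squares R \<union> a_inv R ` unit_squares R"

text \<open>Passes to a notion for arbitrary rings, which then serves \<open>ZFact M\<close>,
  \<open>ZFact N\<close>, \<open>ZFact (M * N)\<close> and the product ring alike.\<close>

lemma quad_units_eq: "quad_units n = unit_squares (ZFact n)"
proof -
  interpret cring "ZFact n" by (rule ZFact_is_cring)
  show ?thesis
    by (force simp: quad_units_def unit_squares_def numeral_2_eq_2 Units_closed)
qed

lemma pm_quad_units_eq: "pm_quad_units n = pm_unit_squares (ZFact n)"
  by (auto simp: pm_quad_units_def pm_unit_squares_def quad_units_eq)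

context cring
begin

lemma unit_squares_closed: "unit_squares R \<subseteq> carrier R"
  by (auto simp: unit_squares_def)

lemma pm_unit_squares_closed: "pm_unit_squares R \<subseteq> carrier R"
  using unit_squares_closed by (auto simp: pm_unit_squares_def)

lemma one_in_unit_squares: "\<one> \<in> unit_squares R"
  by (force simp: unit_squares_def)

lemma unit_squares_mult:
  assumes "q \<in> unit_squares R" "r \<in> unit_squares R"
  shows "q \<otimes> r \<in> unit_squares R"
proof -
  obtain u v where uv: "u \<in> Units R" "v \<in> Units R" "q = u \<otimes> u" "r = v \<otimes> v"
    using assms by (auto simp: unit_squares_def)
  then have "q \<otimes> r = (u \<otimes> v) \<otimes> (u \<otimes> v)"
    by (simp add: Units_closed m_ac)
  then show ?thesis
    using uv by (auto simp: unit_squares_def)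
qed

lemma minus_in_unit_squares:
  assumes "\<ominus> \<one> \<in> unit_squares R" "q \<in> unit_squares R"
  shows "\<ominus> q \<in> unit_squares R"
  using unit_squares_mult[OF assms] assms(2) unit_squares_closed by (auto simp: l_minus)

text \<open>With \<open>q\<close> the square of \<open>u\<close>, multiplying the square
  \<open>\<ominus> q\<close> by the square of \<open>inv u\<close> leaves
  \<open>\<ominus> \<one>\<close>. Hence the squares and their negatives are disjoint unless
  \<open>\<ominus> \<one>\<close> is a square.\<close>

lemma minus_one_in_unit_squares:
  assumes "q \<in> unit_squares R" "\<ominus> q \<in> unit_squares R"
  shows "\<ominus> \<one> \<in> unit_squares R"
proof -
  obtain u where u: "u \<in> Units R" "q = u \<otimes> u"
    using assms by (auto simp: unit_squares_def)
  let ?r = "inv u \<otimes> inv u"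
  have "q \<otimes> ?r = \<one>"
    using u by (simp add: Units_closed m_assoc) (simp add: Units_closed flip: m_assoc)
  then have "\<ominus> q \<otimes> ?r = \<ominus> \<one>"
    using u by (simp add: l_minus Units_closed)
  moreover have "?r \<in> unit_squares R"
    using u by (auto simp: unit_squares_def)
  ultimately show ?thesis
    using unit_squares_mult[OF assms(2)] by metis
qed

lemma card_minus_unit_squares: "card (a_inv R ` unit_squares R) = card (unit_squares R)"
  using unit_squares_closed by (intro card_image inj_onI) (metis minus_minus subsetD)

text \<open>A union bound. It serves for \<open>ZFact (M * N)\<close>, where only an upper estimate
  of the degree enters.\<close>

lemma card_pm_unit_squares_le: "card (pm_unit_squares R) \<le> 2 * card (unit_squares R)"
  using card_Un_le[of "unit_squares R" "a_inv R ` unit_squares R"]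
  by (simp add: pm_unit_squares_def card_minus_unit_squares)

text \<open>The two halves of the union have equal size, and a common element would make
  \<open>\<ominus> \<one>\<close> a square.\<close>

lemma card_pm_unit_squares:
  assumes "finite (carrier R)" "\<ominus> \<one> \<notin> unit_squares R"
  shows "card (pm_unit_squares R) = 2 * card (unit_squares R)"
proof -
  have "finite (unit_squares R)"
    using assms(1) unit_squares_closed finite_subset by blast
  moreover have "unit_squares R \<inter> a_inv R ` unit_squares R = {}"
    using assms(2) minus_one_in_unit_squares unit_squares_closed by fastforce
  ultimately show ?thesis
    by (simp add: pm_unit_squares_def card_Un_disjoint card_minus_unit_squares)
qed

end

section \<open>Transport along ring isomorphisms\<close>

lemma ring_iso_a_inv:
  assumes "ring R" "ring S" "h \<in> ring_iso R S" "x \<in> carrier R"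
  shows "h (\<ominus>\<^bsub>R\<^esub> x) = \<ominus>\<^bsub>S\<^esub> h x"
proof -
  interpret ring_hom_ring R S h
    using assms by (intro ring_hom_ringI2) (auto simp: ring_iso_def)
  show ?thesis using assms(4) by simp
qed

lemma ring_iso_Units:
  assumes "ring R" "h \<in> ring_iso R S"
  shows "h ` Units R = Units S"
proof -
  interpret R: ring R by fact
  note h = ring_iso_memE[OF assms(2)]
  have "h ` Units R \<subseteq> Units S"
  proof
    fix s assume "s \<in> h ` Units R"
    then obtain x y where xy: "x \<in> carrier R" "y \<in> carrier R" "s = h x"
        "y \<otimes>\<^bsub>R\<^esub> x = \<one>\<^bsub>R\<^esub>" "x \<otimes>\<^bsub>R\<^esub> y = \<one>\<^bsub>R\<^esub>"
      unfolding Units_def by blast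
    then have "h y \<otimes>\<^bsub>S\<^esub> s = \<one>\<^bsub>S\<^esub>" "s \<otimes>\<^bsub>S\<^esub> h y = \<one>\<^bsub>S\<^esub>"
      using h(2)[of x y] h(2)[of y x] h(4) by simp_all
    then show "s \<in> Units S"
      using xy h(1) unfolding Units_def by blast
  qed
  moreover have "s \<in> h ` Units R" if s: "s \<in> Units S" for s
  proof -
    obtain t where t: "s \<in> carrier S" "t \<in> carrier S"
        "t \<otimes>\<^bsub>S\<^esub> s = \<one>\<^bsub>S\<^esub>" "s \<otimes>\<^bsub>S\<^esub> t = \<one>\<^bsub>S\<^esub>"
      using s unfolding Units_def by auto
    \<comment> \<open>Surjectivity pulls \<open>s\<close> and its inverse \<open>t\<close> back to
      \<open>x\<close> and \<open>y\<close>; injectivity then turns the equations between images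
      into equations in \<open>R\<close>.\<close>
    then obtain x y where xy: "x \<in> carrier R" "s = h x" "y \<in> carrier R" "t = h y"
      using h(5) unfolding bij_betw_def by (metis imageE)
    then have "h (y \<otimes>\<^bsub>R\<^esub> x) = h \<one>\<^bsub>R\<^esub>" "h (x \<otimes>\<^bsub>R\<^esub> y) = h \<one>\<^bsub>R\<^esub>"
      using t by (simp_all add: h(2,4))
    moreover have "inj_on h (carrier R)"
      using h(5) by (simp add: bij_betw_def)
    ultimately have "y \<otimes>\<^bsub>R\<^esub> x = \<one>\<^bsub>R\<^esub>" "x \<otimes>\<^bsub>R\<^esub> y = \<one>\<^bsub>R\<^esub>"
      using xy by (meson R.m_closed R.one_closed inj_onD)+
    then show ?thesis
      using xy by (auto simp: Units_def)
  qed
  ultimately show ?thesis by blast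
qed

lemma ring_iso_unit_squares:
  assumes "ring R" "h \<in> ring_iso R S"
  shows "h ` unit_squares R = unit_squares S"
proof -
  interpret R: ring R by fact
  have "h ` unit_squares R = (\<lambda>u. u \<otimes>\<^bsub>S\<^esub> u) ` h ` Units R"
    using ring_iso_memE(2)[OF assms(2)] by (simp add: unit_squares_def image_image R.Units_closed)
  then show ?thesis
    by (simp add: ring_iso_Units[OF assms] unit_squares_def)
qed

lemma ring_iso_pm_unit_squares:
  assumes "cring R" "ring S" "h \<in> ring_iso R S"
  shows "h ` pm_unit_squares R = pm_unit_squares S"
proof -
  interpret R: cring R by fact
  have "h ` a_inv R ` unit_squares R = a_inv S ` h ` unit_squares R"
    unfolding image_image using ring_iso_a_inv[OF R.ring_axioms assms(2,3)] R.unit_squares_closed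
    by (intro image_cong) auto
  then show ?thesis
    by (simp add: pm_unit_squares_def image_Un ring_iso_unit_squares[OF R.ring_axioms assms(3)])
qed

section \<open>Direct products of rings\<close>

lemma RDirProd_simps:
  "(a, b) \<otimes>\<^bsub>RDirProd A B\<^esub> (c, d) = (a \<otimes>\<^bsub>A\<^esub> c, b \<otimes>\<^bsub>B\<^esub> d)"
  "(a, b) \<oplus>\<^bsub>RDirProd A B\<^esub> (c, d) = (a \<oplus>\<^bsub>A\<^esub> c, b \<oplus>\<^bsub>B\<^esub> d)"
  "\<one>\<^bsub>RDirProd A B\<^esub> = (\<one>\<^bsub>A\<^esub>, \<one>\<^bsub>B\<^esub>)"
  "\<zero>\<^bsub>RDirProd A B\<^esub> = (\<zero>\<^bsub>A\<^esub>, \<zero>\<^bsub>B\<^esub>)"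
  by (auto simp: RDirProd_def DirProd_def monoid.defs)

lemma RDirProd_a_inv:
  assumes "ring A" "ring B" "a \<in> carrier A" "b \<in> carrier B"
  shows "\<ominus>\<^bsub>RDirProd A B\<^esub> (a, b) = (\<ominus>\<^bsub>A\<^esub> a, \<ominus>\<^bsub>B\<^esub> b)"
proof -
  interpret A: ring A by fact
  interpret B: ring B by fact
  interpret P: ring "RDirProd A B" using assms(1,2) by (rule RDirProd_ring)
  show ?thesis
    using assms(3,4)
    by (intro P.minus_equality) (auto simp: RDirProd_simps RDirProd_carrier A.l_neg B.l_neg)
qed

lemma RDirProd_a_minus:
  assumes "ring A" "ring B" "c \<in> carrier A" "d \<in> carrier B"
  shows "(a, b) \<ominus>\<^bsub>RDirProd A B\<^esub> (c, d) = (a \<ominus>\<^bsub>A\<^esub> c, b \<ominus>\<^bsub>B\<^esub> d)"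
  using assms by (simp add: a_minus_def RDirProd_a_inv RDirProd_simps)

lemma RDirProd_cring:
  assumes "cring A" "cring B"
  shows "cring (RDirProd A B)"
proof -
  interpret A: cring A by fact
  interpret B: cring B by fact
  interpret P: ring "RDirProd A B"
    using A.ring_axioms B.ring_axioms by (rule RDirProd_ring)
  show ?thesis
    by unfold_locales (auto simp: RDirProd_simps RDirProd_carrier A.m_comm B.m_comm)
qed

lemma Units_RDirProd: "Units (RDirProd A B) = Units A \<times> Units B"
  by (auto simp: Units_def RDirProd_simps RDirProd_carrier) blast

lemma unit_squares_RDirProd:
  "unit_squares (RDirProd A B) = unit_squares A \<times> unit_squares B"
  by (force simp: unit_squares_def Units_RDirProd RDirProd_simps)

text \<open>Write Q and Q' for the squares of units in \<open>A\<close> and \<open>B\<close>. The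
  left side is the union of Q x Q' and (-Q) x (-Q'), while the right side also admits mixed signs.
  If -Q = Q, both become Q x (Q' \<union> -Q'); the case -Q' = Q' is symmetric.\<close>

lemma pm_unit_squares_RDirProd:
  assumes "cring A" "cring B" "\<ominus>\<^bsub>A\<^esub> \<one>\<^bsub>A\<^esub> \<in> unit_squares A \<or> \<ominus>\<^bsub>B\<^esub> \<one>\<^bsub>B\<^esub> \<in> unit_squares B"
  shows "pm_unit_squares (RDirProd A B) = pm_unit_squares A \<times> pm_unit_squares B"
proof -
  interpret A: cring A by fact
  interpret B: cring B by fact
  have neg: "a_inv (RDirProd A B) ` (unit_squares A \<times> unit_squares B) =
      a_inv A ` unit_squares A \<times> a_inv B ` unit_squares B"
  proof -
    have "a_inv (RDirProd A B) ` (unit_squares A \<times> unit_squares B) =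
        map_prod (a_inv A) (a_inv B) ` (unit_squares A \<times> unit_squares B)"
      using A.unit_squares_closed B.unit_squares_closed
      by (intro image_cong) (auto simp: RDirProd_a_inv A.ring_axioms B.ring_axioms subset_iff)
    then show ?thesis by (simp add: map_prod_surj_on)
  qed
  \<comment> \<open>Negation maps the squares into themselves; being an involution, it maps them
    onto themselves, each \<open>x\<close> being the image of its negative.\<close>
  have "a_inv A ` unit_squares A = unit_squares A" if "\<ominus>\<^bsub>A\<^esub> \<one>\<^bsub>A\<^esub> \<in> unit_squares A"
    using A.minus_in_unit_squares[OF that] A.unit_squares_closed
    by (auto intro!: image_eqI[where x = "\<ominus>\<^bsub>A\<^esub> x" for x])
  moreover have "a_inv B ` unit_squares B = unit_squares B" if "\<ominus>\<^bsub>B\<^esub> \<one>\<^bsub>B\<^esub> \<in> unit_squares B"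
    using B.minus_in_unit_squares[OF that] B.unit_squares_closed
    by (auto intro!: image_eqI[where x = "\<ominus>\<^bsub>B\<^esub> x" for x])
  ultimately show ?thesis
    using assms(3) unfolding pm_unit_squares_def unit_squares_RDirProd neg by auto
qed

section \<open>Cayley graphs: products, transport and degrees\<close>

lemma tensor_product_cayley_graph:
  assumes "ring A" "ring B"
  shows "tensor_product (cayley_graph A S) (cayley_graph B T) = cayley_graph (RDirProd A B) (S \<times> T)"
  using RDirProd_a_minus[OF assms]
  by (auto simp: tensor_product_def cayley_graph_def RDirProd_carrier)

lemma pair_wf_digraph_cayley_graph: "pair_wf_digraph (cayley_graph R S)"
  by unfold_locales (auto simp: cayley_graph_def)

text \<open>The map \<open>h\<close> itself is the graph isomorphism, because it carries differences
  to differences.\<close>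

lemma graph_iso_cayley_graph:
  assumes "ring R" "ring R'" "h \<in> ring_iso R R'" "S \<subseteq> carrier R"
  shows "graph_iso (cayley_graph R S) (cayley_graph R' (h ` S))"
proof -
  interpret R: ring R by fact
  note h = ring_iso_memE[OF assms(3)]
  have minus: "h a \<ominus>\<^bsub>R'\<^esub> h b = h (a \<ominus>\<^bsub>R\<^esub> b)" if "a \<in> carrier R" "b \<in> carrier R" for a b
    using that by (simp add: a_minus_def h(3) ring_iso_a_inv[OF assms(1-3)])
  \<comment> \<open>This makes \<open>h\<close> reflect adjacency and not only preserve it.\<close>
  have inj: "h x \<in> h ` S \<longleftrightarrow> x \<in> S" if "x \<in> carrier R" for x
    using inj_on_image_mem_iff[of h "carrier R" x S] that assms(4) h(5) by (simp add: bij_betw_def)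
  show ?thesis
    unfolding graph_iso_iff[OF pair_wf_digraph_cayley_graph pair_wf_digraph_cayley_graph]
    using h(1,5) by (intro exI[of _ h]) (auto simp: cayley_graph_def minus inj)
qed

text \<open>Regularity: subtraction from \<open>a\<close> is its own inverse and exchanges the
  neighbours of \<open>a\<close> with \<open>S\<close>.\<close>

lemma card_cayley_graph_neighbours:
  assumes "ring R" "S \<subseteq> carrier R" "a \<in> carrier R"
  shows "card {b. (a, b) \<in> parcs (cayley_graph R S)} = card S"
proof -
  interpret R: ring R by fact
  have inv: "a \<ominus>\<^bsub>R\<^esub> (a \<ominus>\<^bsub>R\<^esub> s) = s" if "s \<in> carrier R" for s
    using assms(3) that by (simp add: R.minus_eq R.minus_add R.r_neg2)
  have "bij_betw (\<lambda>b. a \<ominus>\<^bsub>R\<^esub> b) {b. (a, b) \<in> parcs (cayley_graph R S)} S"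
    using assms(2,3) inv
    by (intro bij_betw_byWitness[where f' = "\<lambda>s. a \<ominus>\<^bsub>R\<^esub> s"]) (auto simp: cayley_graph_def subset_iff)
  then show ?thesis by (rule bij_betw_same_card)
qed

text \<open>By regularity the degree can be read off at any vertex, so it suffices to compare the
  neighbourhoods of zero and of its image.\<close>

lemma graph_iso_cayley_graph_card:
  assumes "ring R" "ring R'" "S \<subseteq> carrier R" "S' \<subseteq> carrier R'"
    and "graph_iso (cayley_graph R S) (cayley_graph R' S')"
  shows "card S = card S'"
proof -
  interpret R: ring R by fact
  obtain f where f: "bij_betw f (carrier R) (carrier R')"
    and adj: "\<And>a b. a \<in> carrier R \<Longrightarrow> b \<in> carrier R \<Longrightarrow>
      (a, b) \<in> parcs (cayley_graph R S) \<longleftrightarrow> (f a, f b) \<in> parcs (cayley_graph R' S')"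
    using assms(5)
    unfolding graph_iso_iff[OF pair_wf_digraph_cayley_graph pair_wf_digraph_cayley_graph]
    by (auto simp: cayley_graph_def)
  let ?N = "{b. (\<zero>\<^bsub>R\<^esub>, b) \<in> parcs (cayley_graph R S)}"
  let ?N' = "{b. (f \<zero>\<^bsub>R\<^esub>, b) \<in> parcs (cayley_graph R' S')}"
  have sub: "?N \<subseteq> carrier R" "?N' \<subseteq> carrier R'"
    by (auto simp: cayley_graph_def)
  have "f ` ?N = ?N'"
  proof
    show "f ` ?N \<subseteq> ?N'" using adj sub(1) by blast
    show "?N' \<subseteq> f ` ?N"
    proof
      fix y assume y: "y \<in> ?N'"
      then obtain b where "b \<in> carrier R" "y = f b"
        using sub(2) f by (auto simp: bij_betw_def)
      then show "y \<in> f ` ?N" using y adj by auto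
    qed
  qed
  then have "card ?N = card ?N'"
    using bij_betw_same_card[OF bij_betw_subset[OF f sub(1)]] by simp
  moreover have "f \<zero>\<^bsub>R\<^esub> \<in> carrier R'" using f by (auto simp: bij_betw_def)
  ultimately show ?thesis
    using card_cayley_graph_neighbours assms(1-4) by (metis R.zero_closed)
qed

section \<open>Residue rings: finiteness and the Chinese remainder theorem\<close>

lemma finite_carrier_ZFact:
  assumes "n \<ge> 1"
  shows "finite (carrier (ZFact n))"
proof -
  have "carrier (ZFact n) = range (ZMod n)"
    by (auto simp: ZFact_defs ZMod_def A_RCOSETS_def')
  also have "\<dots> \<subseteq> ZMod n ` {0..<n}"
  proof
    fix X assume "X \<in> range (ZMod n)"
    then obtain a where "X = ZMod n a" by auto
    \<comment> \<open>As \<open>n\<close> is positive, the representative \<open>a mod n\<close>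
      lies in \<open>{0..<n}\<close>.\<close>
    then have "X = ZMod n (a mod n)" by (simp flip: ZMod_mod)
    then show "X \<in> ZMod n ` {0..<n}" using assms by auto
  qed
  finally show ?thesis by (rule finite_subset) simp
qed

text \<open>Coprimality makes the two ideals intersect in the ideal of the product and, by Bezout,
  add up to the whole ring.\<close>

lemma ZFact_mult_iso:
  assumes "coprime M N"
  shows "ZFact (M * N) \<simeq> RDirProd (ZFact M) (ZFact N)"
proof -
  have "Idl\<^bsub>\<Z>\<^esub> {M} \<inter> Idl\<^bsub>\<Z>\<^esub> {N} = Idl\<^bsub>\<Z>\<^esub> {M * N}"
  proof -
    have "M dvd x \<and> N dvd x \<longleftrightarrow> M * N dvd x" for x
      using assms by (auto intro: divides_mult dvd_mult_left dvd_mult_right)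
    then show ?thesis
      by (auto simp: int_Idl dvd_def mult.commute)
  qed
  moreover have "Idl\<^bsub>\<Z>\<^esub> {M} <+>\<^bsub>\<Z>\<^esub> Idl\<^bsub>\<Z>\<^esub> {N} = UNIV"
  proof -
    obtain u v where "u * M + v * N = 1"
      using assms bezout_int[of M N] by auto
    then have "x = (x * u) * M + (x * v) * N" for x
      by (metis distrib_left mult.assoc mult.right_neutral)
    then show ?thesis
      by (fastforce simp: int_Idl set_add_def')
  qed
  ultimately show ?thesis
    using ring.chinese_remainder_simple[OF int.ring_axioms, of "Idl\<^bsub>\<Z>\<^esub> {M}" "Idl\<^bsub>\<Z>\<^esub> {N}"]
    by (simp add: ZFact_def int.genideal_ideal)
qed

section \<open>Comparison of the two graphs\<close>

theorem theorem1:
  fixes M N :: int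
  assumes "M \<ge> 1" and "N \<ge> 1" and "coprime M N"
  shows "graph_iso (tensor_product (quad_cayley_graph M) (quad_cayley_graph N))
           (quad_cayley_graph (M * N))
    \<longleftrightarrow> \<ominus>\<^bsub>ZFact M\<^esub> \<one>\<^bsub>ZFact M\<^esub> \<in> quad_units M \<or> \<ominus>\<^bsub>ZFact N\<^esub> \<one>\<^bsub>ZFact N\<^esub> \<in> quad_units N"
proof -
  let ?A = "ZFact M" and ?B = "ZFact N" and ?R = "ZFact (M * N)"
  let ?P = "RDirProd ?A ?B" and ?S = "pm_unit_squares ?A \<times> pm_unit_squares ?B"
  interpret A: cring ?A by (rule ZFact_is_cring)
  interpret B: cring ?B by (rule ZFact_is_cring)
  interpret R: cring ?R by (rule ZFact_is_cring)
  interpret P: cring ?P by (rule RDirProd_cring[OF A.cring_axioms B.cring_axioms])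
  obtain h where h: "h \<in> ring_iso ?P ?R"
    using ring_iso_sym[OF R.ring_axioms ZFact_mult_iso[OF assms(3)]] by (auto simp: is_ring_iso_def)
  have S: "?S \<subseteq> carrier ?P"
    using A.pm_unit_squares_closed B.pm_unit_squares_closed by (auto simp: RDirProd_carrier)
  \<comment> \<open>The tensor product is replaced by the Cayley graph of the product ring with
    connection set \<open>?S\<close>.\<close>
  have "graph_iso (cayley_graph ?P ?S) (cayley_graph ?R (pm_unit_squares ?R)) \<longleftrightarrow>
      \<ominus>\<^bsub>?A\<^esub> \<one>\<^bsub>?A\<^esub> \<in> unit_squares ?A \<or> \<ominus>\<^bsub>?B\<^esub> \<one>\<^bsub>?B\<^esub> \<in> unit_squares ?B"
  proof
    assume "\<ominus>\<^bsub>?A\<^esub> \<one>\<^bsub>?A\<^esub> \<in> unit_squares ?A \<or> \<ominus>\<^bsub>?B\<^esub> \<one>\<^bsub>?B\<^esub> \<in> unit_squares ?B"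
    then have "h ` ?S = pm_unit_squares ?R"
      using ring_iso_pm_unit_squares[OF P.cring_axioms R.ring_axioms h]
        pm_unit_squares_RDirProd[OF A.cring_axioms B.cring_axioms] by simp
    then show "graph_iso (cayley_graph ?P ?S) (cayley_graph ?R (pm_unit_squares ?R))"
      using graph_iso_cayley_graph[OF P.ring_axioms R.ring_axioms h S] by simp
  next
    assume iso: "graph_iso (cayley_graph ?P ?S) (cayley_graph ?R (pm_unit_squares ?R))"
    show "\<ominus>\<^bsub>?A\<^esub> \<one>\<^bsub>?A\<^esub> \<in> unit_squares ?A \<or> \<ominus>\<^bsub>?B\<^esub> \<one>\<^bsub>?B\<^esub> \<in> unit_squares ?B"
    proof (rule ccontr)
      assume neg: "\<not> ?thesis"
      let ?a = "card (unit_squares ?A)" and ?b = "card (unit_squares ?B)"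
      have fin: "finite (carrier ?A)" "finite (carrier ?B)"
        using assms by (simp_all add: finite_carrier_ZFact)
      have "card (unit_squares ?R) = card (unit_squares ?P)"
        using h P.unit_squares_closed ring_iso_unit_squares[OF P.ring_axioms h]
        by (metis bij_betw_def card_image inj_on_subset ring_iso_memE(5))
      then have "card (unit_squares ?R) = ?a * ?b"
        by (simp add: unit_squares_RDirProd card_cartesian_product)
      \<comment> \<open>An isomorphism forces equal degrees, and without \<open>-1\<close> among the
        squares each factor of \<open>?S\<close> has twice as many elements as its set of
        squares.\<close>
      moreover have "card (pm_unit_squares ?R) = (2 * ?a) * (2 * ?b)"
        using graph_iso_cayley_graph_card[OF P.ring_axioms R.ring_axioms S R.pm_unit_squares_closed iso]
          neg fin by (simp add: card_cartesian_product A.card_pm_unit_squares B.card_pm_unit_squares)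
      ultimately have "(2 * ?a) * (2 * ?b) \<le> 2 * (?a * ?b)"
        using R.card_pm_unit_squares_le by simp
      then have "?a * ?b = 0" by simp
      \<comment> \<open>Both sets of squares are finite and contain one, so neither cardinality is
        zero.\<close>
      moreover have "?a \<noteq> 0" "?b \<noteq> 0"
        using fin A.one_in_unit_squares B.one_in_unit_squares A.unit_squares_closed B.unit_squares_closed
        by (auto simp: card_eq_0_iff dest: finite_subset)
      ultimately show False by simp
    qed
  qed
  then show ?thesis
    by (simp add: quad_cayley_graph_def pm_quad_units_eq quad_units_eq
        tensor_product_cayley_graph A.ring_axioms B.ring_axioms)
qed

end
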